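(* Let $P\subset\mathbb{R}^d$ be a finite point set, let $\epsilon\in(0,1)$ and $s\in(0,1)$, and set $\xi=s\frac{\epsilon}{1+\epsilon}$. Run the following iterative procedure: initially $T=\{p\}$ for an arbitrary $p\in P$; in the $i$-th iteration, letting $c_i$ be the center of $\mathbf{MEB}(T)$ and $r_i=\mathbf{Rad}(T)$, compute any point $o_i$ with $\|c_i-o_i\|<\xi r_i$, let $q$ be a point of $P$ farthest from $o_i$; if $\|q-o_i\|\le(1+\epsilon)\mathbf{Rad}(P)$ stop (the ball $\mathbb{B}(o_i,(1+\epsilon)\mathbf{Rad}(P))$ then covers $P$), otherwise add $q$ to $T$ and continue. Then the final set $T$ (the core-set) has size bounded by $z=\frac{2}{(1-s)\epsilon}$; in particular this bound can be made arbitrarily close to $2/\epsilon$ by choosing $s$ small enough.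
   Context: For a finite set $P\subset\mathbb{R}^d$, $\mathbf{MEB}(P)$ denotes the (unique) closed ball of minimum radius containing $P$ and $\mathbf{Rad}(P)$ denotes its radius. $\mathbb{B}(c,r)$ denotes the closed Euclidean ball with center $c$ and radius $r$, and $\|\cdot\|$ the Euclidean norm.
   Formalization: In the first iteration T={p} has r_1=0, so no point o_1 satisfies ‖c_1−o_1‖<ξ r_1; the formal procedure takes o_i=c_i when r_i=0 and keeps the strict inequality when r_i>0. *)

theory Defs
  imports "HOL-Analysis.Analysis"
begin

definition is_meb :: "'a::euclidean_space set \<Rightarrow> 'a \<Rightarrow> real \<Rightarrow> bool" where
  "is_meb P c r \<longleftrightarrow>
     0 \<le> r \<and> P \<subseteq> cball c r \<and> (\<forall>c' r'. 0 \<le> r' \<and> P \<subseteq> cball c' r' \<longrightarrow> r \<le> r')"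

definition meb_center :: "'a::euclidean_space set \<Rightarrow> 'a" where
  "meb_center P = (THE c. \<exists>r. is_meb P c r)"

definition Rad :: "'a::euclidean_space set \<Rightarrow> real" where
  "Rad P = (THE r. \<exists>c. is_meb P c r)"

lemma is_meb_exists:
  fixes P :: "'a::euclidean_space set"
  assumes "finite P" "P \<noteq> {}"
  shows "\<exists>c r. is_meb P c r"
proof -
  obtain p where p: "p \<in> P" using assms by blast
  obtain R where R: "P \<subseteq> cball p R" "0 \<le> R"
    using assms(1) by (meson bounded_subset_ballD ball_subset_cball finite_imp_bounded less_eq_real_def subset_trans)
  define K where "K = {z :: 'a \<times> real. \<forall>x\<in>P. dist (fst z) x \<le> snd z} \<inter> (cball p R \<times> {0..R})"
  have "{z :: 'a \<times> real. \<forall>x\<in>P. dist (fst z) x \<le> snd z}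
      = (\<Inter>x\<in>P. {z. dist (fst z) x \<le> snd z})" by auto
  moreover have "closed (\<Inter>x\<in>P. {z :: 'a \<times> real. dist (fst z) x \<le> snd z})"
    by (intro closed_INT ballI closed_Collect_le continuous_intros)
  ultimately have "compact K"
    unfolding K_def by (intro closed_Int_compact compact_Times) auto
  moreover have "(p, R) \<in> K" using R by (auto simp: K_def subset_iff)
  ultimately obtain z where z: "z \<in> K" "\<And>y. y \<in> K \<Longrightarrow> snd z \<le> snd y"
    using continuous_attains_inf[of K snd] continuous_on_snd[OF continuous_on_id] by blast
  have "is_meb P (fst z) (snd z)"
    unfolding is_meb_def
  proof (intro conjI allI impI)
    show "0 \<le> snd z" "P \<subseteq> cball (fst z) (snd z)" using z(1) by (auto simp: K_def)
    fix c' :: 'a and r' :: real assume *: "0 \<le> r' \<and> P \<subseteq> cball c' r'"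
    show "snd z \<le> r'"
    proof (cases "r' \<le> R")
      case True
      have "dist p c' \<le> r'" using * p by (auto simp: subset_iff dist_commute)
      then have "(c', r') \<in> K" using * True by (auto simp: K_def subset_iff)
      then show ?thesis using z(2) by fastforce
    next
      case False
      then show ?thesis using z(1) by (auto simp: K_def)
    qed
  qed
  then show ?thesis by blast
qed

lemma is_meb_unique:
  fixes P :: "'a::euclidean_space set"
  assumes "P \<noteq> {}" "is_meb P c r" "is_meb P c' r'"
  shows "c = c' \<and> r = r'"
proof -
  have r: "r = r'" using assms(2,3) unfolding is_meb_def by (meson order_antisym)
  have "c = c'"
  proof (rule ccontr)
    assume ne: "c \<noteq> c'"
    define m where "m = (1/2) *\<^sub>R (c + c')"
    define t where "t = r\<^sup>2 - (norm (c - c'))\<^sup>2 / 4"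
    have le: "(norm (m - x))\<^sup>2 \<le> t" if "x \<in> P" for x
    proof -
      have "(norm (c - x))\<^sup>2 \<le> r\<^sup>2" "(norm (c' - x))\<^sup>2 \<le> r\<^sup>2"
        using that assms(2,3) r unfolding is_meb_def by (auto simp: dist_norm subset_iff intro!: power_mono)
      moreover have "(norm (m - x))\<^sup>2 = (norm (c - x))\<^sup>2 / 2 + (norm (c' - x))\<^sup>2 / 2 - (norm (c - c'))\<^sup>2 / 4"
        unfolding m_def power2_norm_eq_inner
        by (simp add: inner_diff inner_add inner_commute field_simps)
      ultimately show ?thesis by (simp add: t_def)
    qed
    then have "0 \<le> t" using assms(1) by (metis ex_in_conv order_trans zero_le_power2)
    have "P \<subseteq> cball m (sqrt t)"
      using le by (auto simp: dist_norm real_le_rsqrt)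
    then have "r \<le> sqrt t" using assms(2) \<open>0 \<le> t\<close> unfolding is_meb_def by simp
    then have "r\<^sup>2 \<le> t"
      using assms(2) \<open>0 \<le> t\<close> unfolding is_meb_def by (metis power_mono real_sqrt_pow2)
    then show False using ne by (simp add: t_def)
  qed
  with r show ?thesis by simp
qed

lemma is_meb_center_Rad:
  assumes "finite P" "P \<noteq> {}"
  shows "is_meb P (meb_center P) (Rad P)"
proof -
  obtain c r where cr: "is_meb P c r" using is_meb_exists[OF assms] by blast
  have "meb_center P = c" "Rad P = r"
    unfolding meb_center_def Rad_def using cr is_meb_unique[OF assms(2) cr] by blast+
  with cr show ?thesis by simp
qed

text \<open>The second disjunct is needed for the first iteration: a singleton \<open>T\<close> has
  \<open>Rad T = 0\<close>, so no point satisfies the strict inequality, and the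
  approximate centre has to be the centre itself.\<close>

definition approx_center :: "real \<Rightarrow> 'a::euclidean_space set \<Rightarrow> 'a \<Rightarrow> bool" where
  "approx_center \<xi> T o' \<longleftrightarrow>
     norm (meb_center T - o') < \<xi> * Rad T \<or> (Rad T = 0 \<and> o' = meb_center T)"

definition farthest :: "'a::euclidean_space set \<Rightarrow> 'a \<Rightarrow> 'a \<Rightarrow> bool" where
  "farthest P o' q \<longleftrightarrow> q \<in> P \<and> (\<forall>x\<in>P. norm (x - o') \<le> norm (q - o'))"

inductive coreset_step ::
  "'a::euclidean_space set \<Rightarrow> real \<Rightarrow> real \<Rightarrow> 'a set \<Rightarrow> 'a set \<Rightarrow> bool"
  for P \<epsilon> \<xi> where
  "approx_center \<xi> T o' \<Longrightarrow> farthest P o' q \<Longrightarrow> \<not> norm (q - o') \<le> (1 + \<epsilon>) * Rad P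
     \<Longrightarrow> coreset_step P \<epsilon> \<xi> T (insert q T)"

definition coreset_stop ::
  "'a::euclidean_space set \<Rightarrow> real \<Rightarrow> real \<Rightarrow> 'a set \<Rightarrow> 'a \<Rightarrow> bool" where
  "coreset_stop P \<epsilon> \<xi> T o' \<longleftrightarrow>
     approx_center \<xi> T o' \<and> (\<exists>q. farthest P o' q \<and> norm (q - o') \<le> (1 + \<epsilon>) * Rad P)"

text \<open>A run started at \<open>p\<close> ends with the set \<open>T\<close> and with \<open>o'\<close> as the last
  approximate centre.\<close>

definition coreset_final ::
  "'a::euclidean_space set \<Rightarrow> real \<Rightarrow> real \<Rightarrow> 'a \<Rightarrow> 'a set \<Rightarrow> 'a \<Rightarrow> bool" where
  "coreset_final P \<epsilon> \<xi> p T o' \<longleftrightarrow>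
     (coreset_step P \<epsilon> \<xi>)\<^sup>*\<^sup>* {p} T \<and> coreset_stop P \<epsilon> \<xi> T o'"

end

theory Submission
  imports Defs
begin

text \<open>
  Since \<open>\<xi> \<le> s\<epsilon>\<close>, a point at distance more than \<open>(1 + \<epsilon>) R\<close> from an approximate centre has
  distance more than \<open>L = (1 + (1 - s)\<epsilon>) R\<close> from the exact centre, where \<open>R = Rad P\<close>; so the run is
  a run of the exact Badoiu--Clarkson algorithm with parameter \<open>(1 - s)\<epsilon>\<close>.
  If the centre moves by \<open>K\<close> and the radius grows from \<open>r\<close> to \<open>r'\<close> in a step, then \<open>r' \<ge> L - K\<close>
  and \<open>r'\<^sup>2 \<ge> r\<^sup>2 + K\<^sup>2\<close>, hence \<open>2 L r' \<ge> L\<^sup>2 + r\<^sup>2\<close>. Starting from \<open>r = 0\<close>, this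
  recurrence gives \<open>(n + 2) (L - r) \<le> 2 L\<close> as soon as \<open>n = card T \<ge> 2\<close>, and
  \<open>r \<le> R\<close> turns this into a bound on \<open>n\<close>.
\<close>

section \<open>Radius growth of minimum enclosing balls\<close>

text \<open>Stewart's theorem in vector form. The subtracted term measures how much a ball around an
  intermediate centre can shrink.\<close>

lemma norm_convex_combination_diff_sq:
  fixes x c c' :: "'a::real_inner"
  shows "(norm (((1 - t) *\<^sub>R c + t *\<^sub>R c') - x))\<^sup>2
    = (1 - t) * (norm (c - x))\<^sup>2 + t * (norm (c' - x))\<^sup>2 - t * (1 - t) * (norm (c - c'))\<^sup>2"
  unfolding power2_norm_eq_inner
  by (simp add: inner_diff inner_add inner_commute algebra_simps)

text \<open>Minimality of the ball is tested at centres moved slightly from \<open>c\<close> towards \<open>c'\<close>.\<close>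

lemma is_meb_enclosing_radius_sq:
  fixes T :: "'a::euclidean_space set"
  assumes meb: "is_meb T c r" and ne: "T \<noteq> {}" and sub: "T \<subseteq> cball c' r'"
  shows "r\<^sup>2 + (norm (c - c'))\<^sup>2 \<le> r'\<^sup>2"
proof -
  define K where "K = (norm (c - c'))\<^sup>2"
  have r: "0 \<le> r" and Tc: "T \<subseteq> cball c r"
    and min: "\<And>d \<rho>. 0 \<le> \<rho> \<Longrightarrow> T \<subseteq> cball d \<rho> \<Longrightarrow> r \<le> \<rho>"
    using meb by (auto simp: is_meb_def)
  have le: "r\<^sup>2 \<le> r'\<^sup>2 - (1 - t) * K" if t: "0 < t" "t < 1" for t
  proof -
    define m where "m = (1 - t) *\<^sub>R c + t *\<^sub>R c'"
    define b where "b = (1 - t) * r\<^sup>2 + t * r'\<^sup>2 - t * (1 - t) * K"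
    have b: "(norm (m - x))\<^sup>2 \<le> b" if x: "x \<in> T" for x
    proof -
      have "(norm (c - x))\<^sup>2 \<le> r\<^sup>2" "(norm (c' - x))\<^sup>2 \<le> r'\<^sup>2"
        using x Tc sub by (auto simp: dist_norm subset_iff intro!: power_mono)
      then have "(1 - t) * (norm (c - x))\<^sup>2 \<le> (1 - t) * r\<^sup>2" "t * (norm (c' - x))\<^sup>2 \<le> t * r'\<^sup>2"
        using t by (auto intro!: mult_left_mono)
      then show ?thesis
        unfolding m_def b_def K_def norm_convex_combination_diff_sq by linarith
    qed
    then have b0: "0 \<le> b" using ne by (metis ex_in_conv order_trans zero_le_power2)
    have "T \<subseteq> cball m (sqrt b)" using b by (auto simp: dist_norm real_le_rsqrt)
    then have "r \<le> sqrt b" using min b0 by simp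
    then have "r\<^sup>2 \<le> b" using r b0 by (metis power_mono real_sqrt_pow2)
    \<comment> \<open>After cancelling \<open>r\<^sup>2\<close>, every remaining term carries a
      factor \<open>t\<close>; dividing by it leaves only the loss \<open>1 - t\<close> in front of
      \<open>K\<close>, which disappears as \<open>t\<close> tends to 0.\<close>
    then have "t * r\<^sup>2 \<le> t * (r'\<^sup>2 - (1 - t) * K)" by (simp add: b_def algebra_simps)
    then show ?thesis using t by simp
  qed
  have "((\<lambda>t. r'\<^sup>2 - (1 - t) * K) \<longlongrightarrow> r'\<^sup>2 - (1 - 0) * K) (at_right 0)"
    by (intro tendsto_intros)
  moreover have "eventually (\<lambda>t. r\<^sup>2 \<le> r'\<^sup>2 - (1 - t) * K) (at_right 0)"
    unfolding eventually_at_right_field using le by (intro exI[of _ 1]) auto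
  ultimately have "r\<^sup>2 \<le> r'\<^sup>2 - (1 - 0) * K"
    by (intro tendsto_lowerbound) auto
  then show ?thesis by (simp add: K_def)
qed

lemma Rad_mono:
  fixes P :: "'a::euclidean_space set"
  assumes "finite P" "T \<subseteq> P" "T \<noteq> {}"
  shows "Rad T \<le> Rad P"
proof -
  have "is_meb T (meb_center T) (Rad T)" "is_meb P (meb_center P) (Rad P)"
    using assms by (auto intro!: is_meb_center_Rad dest: finite_subset)
  then show ?thesis using assms(2) unfolding is_meb_def by (meson subset_trans)
qed

lemma Rad_pos:
  fixes P :: "'a::euclidean_space set"
  assumes "finite P" "x \<in> P" "y \<in> P" "x \<noteq> y"
  shows "0 < Rad P"
proof (rule ccontr)
  have meb: "is_meb P (meb_center P) (Rad P)" using assms by (auto intro!: is_meb_center_Rad)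
  assume "\<not> 0 < Rad P"
  then have "P \<subseteq> {meb_center P}" using meb by (auto simp: is_meb_def)
  then show False using assms by auto
qed

lemma Rad_insert_far:
  fixes T :: "'a::euclidean_space set"
  assumes "finite T" "T \<noteq> {}" and r: "Rad T \<le> L" and far: "L \<le> norm (q - meb_center T)"
  shows "L\<^sup>2 + (Rad T)\<^sup>2 \<le> 2 * L * Rad (insert q T)"
proof -
  define c c' r r' where "c = meb_center T" and "c' = meb_center (insert q T)"
    and "r = Rad T" and "r' = Rad (insert q T)"
  have meb: "is_meb T c r" and meb': "is_meb (insert q T) c' r'"
    unfolding c_def r_def c'_def r'_def using assms by (auto intro!: is_meb_center_Rad)
  have r0: "0 \<le> r" and sub: "T \<subseteq> cball c' r'" and q: "norm (q - c') \<le> r'"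
    using meb meb' by (auto simp: is_meb_def dist_norm norm_minus_commute)
  have "norm (q - c) \<le> norm (q - c') + norm (c - c')"
    by (metis norm_triangle_ineq4 diff_diff_eq2 diff_add_cancel)
  then have K: "L - r' \<le> norm (c - c')" using far q by (simp add: c_def)
  have sq: "r\<^sup>2 + (norm (c - c'))\<^sup>2 \<le> r'\<^sup>2"
    using is_meb_enclosing_radius_sq[OF meb assms(2) sub] .
  have L: "r \<le> L" using assms(3) by (simp add: r_def)
  \<comment> \<open>Squaring \<open>L - r' \<le> norm (c - c')\<close> requires
    \<open>L - r'\<close> to be nonnegative, after which \<open>r'\<^sup>2\<close> cancels. In the
    other case \<open>r \<le> L \<le> r'\<close> gives the claim directly.\<close>
  have "L\<^sup>2 + r\<^sup>2 \<le> 2 * L * r'"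
  proof (cases "L \<le> r'")
    case True
    have "L\<^sup>2 + r\<^sup>2 \<le> 2 * L * L" using L r0 power_mono[of r L 2] by (simp add: power2_eq_square)
    also have "\<dots> \<le> 2 * L * r'" using True L r0 by (intro mult_left_mono) auto
    finally show ?thesis .
  next
    case False
    then have "(L - r')\<^sup>2 \<le> (norm (c - c'))\<^sup>2" using K by (intro power_mono) auto
    then show ?thesis using sq by (simp add: power2_diff)
  qed
  then show ?thesis by (simp add: r_def r'_def)
qed

section \<open>The scalar recurrence\<close>

text \<open>For the normalised gaps \<open>x = (L - r) / (2 * L)\<close> and \<open>x'\<close>,
  defined likewise from \<open>r'\<close>, the recurrence reads \<open>x' \<le> x * (1 - x)\<close>.
  Where the reciprocals make sense, \<open>1 / x' \<ge> 1 / x + 1\<close>, so the reciprocal gap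
  grows by at least one per step. The polynomial form avoids dividing by a gap that may
  vanish.\<close>

lemma gap_recurrence:
  fixes L r r' n :: real
  assumes "0 < L" "0 \<le> n" "0 \<le> r" "r \<le> L"
    and rec: "L\<^sup>2 + r\<^sup>2 \<le> 2 * L * r'"
    and gap: "(n + 2) * (L - r) \<le> 2 * L"
  shows "(n + 3) * (L - r') \<le> 2 * L"
proof -
  define u v where "u = L - r" and "v = 2 * L - (n + 2) * u"
  have v: "0 \<le> v" using gap by (simp add: v_def u_def)
  have u: "0 \<le> u" "u \<le> L" using assms by (auto simp: u_def)
  have "2 * L * (L - r') \<le> u * (2 * L - u)"
    using rec by (simp add: u_def power2_eq_square algebra_simps)
  then have "(n + 3) * (2 * L * (L - r')) \<le> (n + 3) * (u * (2 * L - u))"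
    using assms(2) by (intro mult_left_mono) auto
  also have "\<dots> \<le> 2 * L * (2 * L)"
  proof -
    \<comment> \<open>Here \<open>v\<close> is the slack in \<open>gap\<close>; substituting
      \<open>2 * L = v + (n + 2) * u\<close> makes the difference a polynomial in \<open>u\<close>
      and \<open>v\<close> with nonnegative coefficients.\<close>
    have "2 * L * (2 * L) - (n + 3) * (u * (2 * L - u)) = u * u + (n + 1) * (u * v) + v * v"
      by (simp add: v_def algebra_simps)
    moreover have "0 \<le> u * u" "0 \<le> (n + 1) * (u * v)" "0 \<le> v * v"
      using u v assms(2) by auto
    ultimately show ?thesis by linarith
  qed
  finally have "2 * L * ((n + 3) * (L - r')) \<le> 2 * L * (2 * L)" by (simp add: algebra_simps)
  then show ?thesis using assms(1) by (subst (asm) mult_le_cancel_left_pos) auto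
qed


section \<open>A single step of the procedure\<close>

lemma coreset_step_far:
  fixes P :: "'a::euclidean_space set"
  assumes fin: "finite P" and eps: "0 < \<epsilon>" and s: "0 < s" and xi: "\<xi> = s * (\<epsilon> / (1 + \<epsilon>))"
    and T: "T \<subseteq> P" "T \<noteq> {}" and step: "coreset_step P \<epsilon> \<xi> T T'"
  obtains q where "q \<in> P" "T' = insert q T" "(1 + (1 - s) * \<epsilon>) * Rad P < norm (q - meb_center T)"
  using step
proof cases
  case (1 o' q)
  have P: "is_meb P (meb_center P) (Rad P)" and "is_meb T (meb_center T) (Rad T)"
    using fin T by (auto intro!: is_meb_center_Rad dest: finite_subset)
  then have R0: "0 \<le> Rad P" and r0: "0 \<le> Rad T" by (auto simp: is_meb_def)
  have xi': "0 \<le> \<xi>" "\<xi> \<le> s * \<epsilon>" using eps s by (auto simp: xi field_simps)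
  \<comment> \<open>The weak inequality covers both disjuncts of \<open>approx_center\<close>: in
    the degenerate one both sides are 0.\<close>
  have "norm (meb_center T - o') \<le> \<xi> * Rad T" using 1(2) by (auto simp: approx_center_def)
  also have "\<dots> \<le> (s * \<epsilon>) * Rad P"
    using xi' r0 R0 Rad_mono[OF fin T] by (intro mult_mono) auto
  finally have "norm (meb_center T - o') \<le> (s * \<epsilon>) * Rad P" .
  moreover have "norm (q - o') \<le> norm (q - meb_center T) + norm (meb_center T - o')"
    using norm_triangle_ineq[of "q - meb_center T" "meb_center T - o'"] by simp
  ultimately have "(1 + (1 - s) * \<epsilon>) * Rad P < norm (q - meb_center T)"
    using 1(4) by (simp add: algebra_simps)
  with that 1 show thesis by (auto simp: farthest_def)
qed

context
  fixes P :: "'a::euclidean_space set" and \<epsilon> s \<xi> :: real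
  assumes fin: "finite P" and eps: "0 < \<epsilon>" and s: "0 < s" "s < 1"
    and xi: "\<xi> = s * (\<epsilon> / (1 + \<epsilon>))"
begin

text \<open>The added point lies farther than \<open>Rad P \<ge> Rad T\<close> from the centre of
  \<open>T\<close>, hence outside the ball of \<open>T\<close>, so it is new and \<open>card\<close>
  counts iterations. It also differs from any point of \<open>T\<close>, which makes
  \<open>Rad P\<close> positive.\<close>

lemma coreset_step_card:
  assumes T: "T \<subseteq> P" "T \<noteq> {}" and step: "coreset_step P \<epsilon> \<xi> T T'"
  shows "T' \<subseteq> P" "T' \<noteq> {}" "card T' = Suc (card T)" "0 < Rad P"
proof -
  obtain q where q: "q \<in> P" "T' = insert q T"
      "(1 + (1 - s) * \<epsilon>) * Rad P < norm (q - meb_center T)"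
    using coreset_step_far[OF fin eps s(1) xi T step] .
  have finT: "finite T" using fin T finite_subset by blast
  then have meb: "is_meb T (meb_center T) (Rad T)" using T by (intro is_meb_center_Rad)
  then have "0 \<le> Rad P" using Rad_mono[OF fin T] by (auto simp: is_meb_def)
  then have "0 \<le> ((1 - s) * \<epsilon>) * Rad P" using eps s by simp
  then have "Rad T < norm (q - meb_center T)"
    using q(3) Rad_mono[OF fin T] by (simp add: algebra_simps)
  then have qT: "q \<notin> T" using meb by (auto simp: is_meb_def dist_norm norm_minus_commute)
  show "T' \<subseteq> P" "T' \<noteq> {}" "card T' = Suc (card T)" using q T qT finT by auto
  from T obtain x where "x \<in> T" by blast
  with q(1) qT T show "0 < Rad P" using Rad_pos[OF fin, of q x] by blast
qed

text \<open>Singletons are a separate case because the gap bound would read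
  \<open>3 * L \<le> 2 * L\<close> there, the radius being 0.\<close>

lemma coreset_step_gap:
  defines "L \<equiv> (1 + (1 - s) * \<epsilon>) * Rad P"
  assumes T: "T \<subseteq> P" "T \<noteq> {}" and step: "coreset_step P \<epsilon> \<xi> T T'"
    and gap: "card T = 1 \<or> (real (card T) + 2) * (L - Rad T) \<le> 2 * L"
  shows "(real (card T') + 2) * (L - Rad T') \<le> 2 * L"
proof -
  obtain q where q: "q \<in> P" "T' = insert q T" "L < norm (q - meb_center T)"
    using coreset_step_far[OF fin eps s(1) xi T step] unfolding L_def .
  note card = coreset_step_card[OF T step]
  have finT: "finite T" using fin T finite_subset by blast
  have meb: "is_meb T (meb_center T) (Rad T)" using T finT by (intro is_meb_center_Rad)
  have r0: "0 \<le> Rad T" using meb by (auto simp: is_meb_def)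
  have "Rad P \<le> L" using card(4) eps s by (simp add: L_def)
  with card(4) Rad_mono[OF fin T] have L: "0 < L" "Rad T \<le> L" by auto
  have rec: "L\<^sup>2 + (Rad T)\<^sup>2 \<le> 2 * L * Rad T'"
    unfolding q(2) using Rad_insert_far[OF finT T(2) L(2)] q(3) by simp
  from gap show ?thesis
  proof
    \<comment> \<open>Dropping the square of \<open>Rad T\<close> leaves
      \<open>Rad T' \<ge> L / 2\<close>, which is exactly the gap bound for two points,
      \<open>4 * (L - Rad T') \<le> 2 * L\<close>.\<close>
    assume 1: "card T = 1"
    have "L * L \<le> L * (2 * Rad T')" using rec r0 mult_nonneg_nonneg[OF r0 r0]
      unfolding power2_eq_square by linarith
    then have "L \<le> 2 * Rad T'" using L(1) by simp
    then show ?thesis using card(3) 1 by simp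
  next
    assume "(real (card T) + 2) * (L - Rad T) \<le> 2 * L"
    from gap_recurrence[OF L(1) _ r0 L(2) rec this] show ?thesis
      by (simp add: card(3) add.commute add.left_commute)
  qed
qed

section \<open>Size of the sets reached by a run\<close>

text \<open>Positivity of \<open>Rad P\<close> is carried along so that it can be cancelled when the
  gap bound is turned into a bound on \<open>card T\<close>.\<close>

lemma coreset_run_invariant:
  defines "L \<equiv> (1 + (1 - s) * \<epsilon>) * Rad P"
  assumes "(coreset_step P \<epsilon> \<xi>)\<^sup>*\<^sup>* {p} T" and p: "p \<in> P"
  shows "T \<subseteq> P \<and> T \<noteq> {} \<and>
    (card T = 1 \<or> 0 < Rad P \<and> (real (card T) + 2) * (L - Rad T) \<le> 2 * L)"
  using assms(2)
proof (induction rule: rtranclp_induct)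
  case base
  then show ?case using p by simp
next
  case (step T T')
  then have T: "T \<subseteq> P" "T \<noteq> {}"
    and gap: "card T = 1 \<or> (real (card T) + 2) * (L - Rad T) \<le> 2 * L" by auto
  show ?case
    using coreset_step_card[OF T step(2)] coreset_step_gap[OF T step(2) gap[unfolded L_def]]
    unfolding L_def by blast
qed

lemma coreset_run_card_le:
  assumes eps1: "\<epsilon> < 1" and run: "(coreset_step P \<epsilon> \<xi>)\<^sup>*\<^sup>* {p} T" and p: "p \<in> P"
  shows "real (card T) \<le> 2 / ((1 - s) * \<epsilon>)"
proof -
  define \<delta> where "\<delta> = (1 - s) * \<epsilon>"
  have \<delta>: "0 < \<delta>" using s eps by (simp add: \<delta>_def)
  have "(1 - s) * \<epsilon> \<le> 1 * 1" using s eps eps1 by (intro mult_mono) auto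
  then have \<delta>1: "\<delta> \<le> 1" by (simp add: \<delta>_def)
  note inv = coreset_run_invariant[OF run p, folded \<delta>_def]
  show ?thesis
  proof (cases "card T = 1")
    case True
    then show ?thesis unfolding \<delta>_def[symmetric] using \<delta> \<delta>1 by (simp add: field_simps)
  next
    case False
    define n where "n = real (card T)"
    have R: "0 < Rad P" and gap: "(n + 2) * ((1 + \<delta>) * Rad P - Rad T) \<le> 2 * ((1 + \<delta>) * Rad P)"
      using inv False by (auto simp: n_def)
    \<comment> \<open>Hence \<open>L - Rad T \<ge> \<delta> * Rad P\<close>, and the gap bound
      becomes \<open>(n + 2) * \<delta> \<le> 2 * (1 + \<delta>)\<close>. The offset 2 absorbs
      exactly the excess \<open>2 * \<delta>\<close>.\<close>
    have "Rad T \<le> Rad P" using inv fin by (intro Rad_mono) auto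
    then have "(n + 2) * (\<delta> * Rad P) \<le> (n + 2) * ((1 + \<delta>) * Rad P - Rad T)"
      by (intro mult_left_mono) (auto simp: n_def algebra_simps)
    with gap have "(n * \<delta>) * Rad P \<le> 2 * Rad P" by (simp add: algebra_simps)
    then have "n * \<delta> \<le> 2" using R by simp
    then show ?thesis unfolding \<delta>_def[symmetric] using \<delta> by (simp add: n_def field_simps)
  qed
qed

section \<open>Termination and existence of a final set\<close>

lemma no_infinite_coreset_run:
  assumes p: "p \<in> P"
  shows "\<nexists>S. S 0 = {p} \<and> (\<forall>i::nat. coreset_step P \<epsilon> \<xi> (S i) (S (Suc i)))"
proof
  assume "\<exists>S. S 0 = {p} \<and> (\<forall>i::nat. coreset_step P \<epsilon> \<xi> (S i) (S (Suc i)))"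
  then obtain S where S0: "S 0 = {p}" and S: "\<And>i::nat. coreset_step P \<epsilon> \<xi> (S i) (S (Suc i))"
    by blast
  have "S i \<subseteq> P \<and> S i \<noteq> {} \<and> card (S i) = Suc i" for i
  proof (induction i)
    case 0
    then show ?case using S0 p by simp
  next
    case (Suc i)
    then show ?case using coreset_step_card(1-3)[OF _ _ S, of i] by simp
  qed
  \<comment> \<open>Taken at \<open>i = card P\<close>, where the set would have more points than
    \<open>P\<close>.\<close>
  then have "Suc (card P) \<le> card P" using card_mono[OF fin] by metis
  then show False by simp
qed

text \<open>The procedure never gets stuck: the exact centre is always an admissible approximate
  centre, and a farthest point exists because \<open>P\<close> is finite.\<close>

lemma coreset_stop_or_step:
  assumes T: "T \<subseteq> P" "T \<noteq> {}"
  shows "(\<exists>o'. coreset_stop P \<epsilon> \<xi> T o') \<or> (\<exists>T'. coreset_step P \<epsilon> \<xi> T T')"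
proof -
  let ?c = "meb_center T"
  have "is_meb T ?c (Rad T)" using fin T by (auto intro!: is_meb_center_Rad dest: finite_subset)
  then have "0 \<le> Rad T" by (simp add: is_meb_def)
  moreover have "0 < \<xi>" using eps s by (simp add: xi)
  ultimately have app: "approx_center \<xi> T ?c"
    by (cases "Rad T = 0") (auto simp: approx_center_def)
  have "Max ((\<lambda>x. norm (x - ?c)) ` P) \<in> (\<lambda>x. norm (x - ?c)) ` P"
    using fin T by (intro Max_in) auto
  then obtain q where "q \<in> P" "norm (q - ?c) = Max ((\<lambda>x. norm (x - ?c)) ` P)" by auto
  then have "farthest P ?c q" using fin by (auto simp: farthest_def)
  with app show ?thesis
    using coreset_step.intros[OF app, of P q \<epsilon>] by (auto simp: coreset_stop_def)
qed

lemma coreset_final_exists: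
  assumes p: "p \<in> P"
  shows "\<exists>T o'. coreset_final P \<epsilon> \<xi> p T o'"
proof (rule ccontr)
  assume no: "\<nexists>T o'. coreset_final P \<epsilon> \<xi> p T o'"
  have next_step: "\<exists>T'. coreset_step P \<epsilon> \<xi> T T'" if run: "(coreset_step P \<epsilon> \<xi>)\<^sup>*\<^sup>* {p} T" for T
    using coreset_stop_or_step[of T] coreset_run_invariant[OF run p] no run
    by (auto simp: coreset_final_def)
  \<comment> \<open>The clause for \<open>i = 0\<close> pins the chosen sequence to the start
    \<open>{p}\<close>; reachability alone would let it begin at any reachable set.\<close>
  have "\<exists>S. \<forall>i. ((coreset_step P \<epsilon> \<xi>)\<^sup>*\<^sup>* {p} (S i) \<and> (i = 0 \<longrightarrow> S i = {p}))
      \<and> coreset_step P \<epsilon> \<xi> (S i) (S (Suc i))"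
  proof (rule dependent_nat_choice)
    fix T and i :: nat
    assume "(coreset_step P \<epsilon> \<xi>)\<^sup>*\<^sup>* {p} T \<and> (i = 0 \<longrightarrow> T = {p})"
    then have run: "(coreset_step P \<epsilon> \<xi>)\<^sup>*\<^sup>* {p} T" by simp
    from next_step[OF run] obtain T' where "coreset_step P \<epsilon> \<xi> T T'" by blast
    with rtranclp.rtrancl_into_rtrancl[OF run this]
    show "\<exists>T'. ((coreset_step P \<epsilon> \<xi>)\<^sup>*\<^sup>* {p} T' \<and> (Suc i = 0 \<longrightarrow> T' = {p}))
        \<and> coreset_step P \<epsilon> \<xi> T T'" by auto
  qed auto
  then show False using no_infinite_coreset_run[OF p] by blast
qed

end

lemma coreset_final_covers:
  assumes "coreset_final P \<epsilon> \<xi> p T o'"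
  shows "P \<subseteq> cball o' ((1 + \<epsilon>) * Rad P)"
  using assms unfolding coreset_final_def coreset_stop_def farthest_def
  by (force simp: dist_norm norm_minus_commute)

theorem theorem1:
  fixes P :: "(real ^ 'd) set" and \<epsilon> s \<xi> :: real
  assumes "finite P"
    and "0 < \<epsilon>" "\<epsilon> < 1"
    and "0 < s" "s < 1"
    and "\<xi> = s * (\<epsilon> / (1 + \<epsilon>))"
  shows "(\<forall>p\<in>P.
            (\<nexists>S. S 0 = {p} \<and> (\<forall>i::nat. coreset_step P \<epsilon> \<xi> (S i) (S (Suc i)))) \<and>
            (\<exists>T o'. coreset_final P \<epsilon> \<xi> p T o') \<and>
            (\<forall>T o'. coreset_final P \<epsilon> \<xi> p T o' \<longrightarrow>
               P \<subseteq> cball o' ((1 + \<epsilon>) * Rad P) \<and>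
               real (card T) \<le> 2 / ((1 - s) * \<epsilon>))) \<and>
         ((\<lambda>\<sigma>. 2 / ((1 - \<sigma>) * \<epsilon>)) \<longlongrightarrow> 2 / \<epsilon>) (at_right 0)"
proof (intro conjI ballI allI impI)
  fix p assume p: "p \<in> P"
  note hyps = assms(1,2,4,5,6)
  show "\<nexists>S. S 0 = {p} \<and> (\<forall>i::nat. coreset_step P \<epsilon> \<xi> (S i) (S (Suc i)))"
    by (rule no_infinite_coreset_run[OF hyps p])
  show "\<exists>T o'. coreset_final P \<epsilon> \<xi> p T o'"
    by (rule coreset_final_exists[OF hyps p])
  fix T o' assume final: "coreset_final P \<epsilon> \<xi> p T o'"
  then show "P \<subseteq> cball o' ((1 + \<epsilon>) * Rad P)" by (rule coreset_final_covers)
  from final show "real (card T) \<le> 2 / ((1 - s) * \<epsilon>)"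
    using coreset_run_card_le[OF hyps assms(3) _ p] by (simp add: coreset_final_def)
next
  have "((\<lambda>\<sigma>. 2 / ((1 - \<sigma>) * \<epsilon>)) \<longlongrightarrow> 2 / ((1 - 0) * \<epsilon>)) (at_right 0)"
    using assms(2) by (intro tendsto_intros) auto
  then show "((\<lambda>\<sigma>. 2 / ((1 - \<sigma>) * \<epsilon>)) \<longlongrightarrow> 2 / \<epsilon>) (at_right 0)" by simp
qed

end
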